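(* For every integer $k\ge 2$, there exists a monotonically growing temporal complete $k$-partite graph $\mathcal{K}$ (that is, a monotonically growing temporal graph whose underlying static graph is complete $k$-partite) such that there is no Nash equilibrium in the two-player reverse temporal Voronoi game $\mathrm{rVor}(\mathcal{K},2)$.
   Context: A temporal graph $\mathcal{G}=(V,(E_t)_{t=1}^\infty)$ consists of a finite nonempty vertex set $V$ and an infinite sequence of edge sets $E_t\subseteq\binom{V}{2}$; it is assumed that the sequence is eventually constant (finite lifetime), i.e. there is $\tau$ with $E_t=E_\tau$ for all $t\ge\tau$. The underlying static graph is $(V,\bigcup_{t\ge1}E_t)$. A temporal complete $k$-partite graph is a temporal graph whose underlying graph is complete $k$-partite (the vertex set is partitioned into $k$ nonempty parts, and two vertices are adjacent if and only if they lie in different parts). $\mathcal{G}$ is monotonically growing if $E_t\subseteq E_{t+1}$ for all $t\ge 1$. A temporal walk from $u$ to $v$ is a sequence $(\{v_0=u,v_1\},t_1),(\{v_1,v_2\},t_2),\dots,(\{v_{d-1},v_d=v\},t_d)$ with $t_i<t_{i+1}$ for all $i\in\{1,\dots,d-1\}$ (strictly increasing times) and $\{v_{i-1},v_i\}\in E_{t_i}$ for all $i\in\{1,\dots,d\}$; its arrival time is $t_d$. The temporal distance $\mathrm{td}(u,v)$ is the minimum arrival time of a temporal walk from $u$ to $v$, with $\mathrm{td}(u,u)=0$ and $\mathrm{td}(u,v)=\infty$ if there is no such walk. In the two-player reverse temporal Voronoi game $\mathrm{rVor}(\mathcal{G},2)$, each player $i\in\{1,2\}$ selects one vertex $p_i\in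 V$ (equal choices are allowed). Player $i$ wins the set $U_i(p_1,p_2)=\{v\in V\mid \mathrm{td}(v,p_i)<\mathrm{td}(v,p_j)\}$, where $j\ne i$ is the other player, and her payoff is $u_i(p_1,p_2)=|U_i(p_1,p_2)|$. A profile $(p_1,p_2)\in V^2$ is a Nash equilibrium if $u_1(p',p_2)\le u_1(p_1,p_2)$ and $u_2(p_1,p')\le u_2(p_1,p_2)$ for all $p'\in V$. *)

theory Defs
  imports "HOL-Library.Disjoint_Sets" "HOL-Library.Extended_Nat"
begin

text \<open>
  The edge sequence is a function on \<open>nat\<close>, but time starts at 1: every definition below
  ignores the value \<open>E 0\<close>.
\<close>

definition temporal_graph :: "'v set \<Rightarrow> (nat \<Rightarrow> 'v set set) \<Rightarrow> bool" where
  "temporal_graph V E \<longleftrightarrow>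
     finite V \<and> V \<noteq> {} \<and>
     (\<forall>t\<ge>1. E t \<subseteq> {e. e \<subseteq> V \<and> card e = 2}) \<and>
     (\<exists>\<tau>\<ge>1. \<forall>t\<ge>\<tau>. E t = E \<tau>)"

definition underlying_edges :: "(nat \<Rightarrow> 'v set set) \<Rightarrow> 'v set set" where
  "underlying_edges E = (\<Union>t\<in>{1..}. E t)"

definition complete_multipartite :: "nat \<Rightarrow> 'v set \<Rightarrow> 'v set set \<Rightarrow> bool" where
  "complete_multipartite k V F \<longleftrightarrow>
     (\<exists>P. partition_on V P \<and> finite P \<and> card P = k \<and>
          F = {{u, v} | u v A B. A \<in> P \<and> B \<in> P \<and> A \<noteq> B \<and> u \<in> A \<and> v \<in> B})"

definition temporal_complete_multipartite ::
    "nat \<Rightarrow> 'v set \<Rightarrow> (nat \<Rightarrow> 'v set set) \<Rightarrow> bool" where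
  "temporal_complete_multipartite k V E \<longleftrightarrow>
     temporal_graph V E \<and> complete_multipartite k V (underlying_edges E)"

definition monotonically_growing :: "(nat \<Rightarrow> 'v set set) \<Rightarrow> bool" where
  "monotonically_growing E \<longleftrightarrow> (\<forall>t\<ge>1. E t \<subseteq> E (Suc t))"

text \<open>
  A walk with \<open>d \<ge> 1\<close> steps is given by its vertices \<open>vs = [v\<^sub>0, \<dots>, v\<^sub>d]\<close> and its
  times \<open>ts = [t\<^sub>1, \<dots>, t\<^sub>d]\<close>; with zero-based lists, step \<open>i\<close> joins \<open>vs ! i\<close> to
  \<open>vs ! Suc i\<close> at time \<open>ts ! i\<close>.
\<close>

definition temporal_walk ::
    "(nat \<Rightarrow> 'v set set) \<Rightarrow> 'v \<Rightarrow> 'v \<Rightarrow> 'v list \<Rightarrow> nat list \<Rightarrow> bool" where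
  "temporal_walk E u v vs ts \<longleftrightarrow>
     ts \<noteq> [] \<and> length vs = Suc (length ts) \<and> hd vs = u \<and> last vs = v \<and>
     sorted_wrt (<) ts \<and>
     (\<forall>i<length ts. 1 \<le> ts ! i \<and> {vs ! i, vs ! Suc i} \<in> E (ts ! i))"

text \<open>The infimum in \<open>enat\<close> is a minimum on nonempty sets and \<open>\<infinity>\<close> on the empty set.\<close>

definition temporal_dist :: "(nat \<Rightarrow> 'v set set) \<Rightarrow> 'v \<Rightarrow> 'v \<Rightarrow> enat" where
  "temporal_dist E u v =
     (if u = v then 0 else Inf {enat (last ts) | vs ts. temporal_walk E u v vs ts})"

text \<open>
  The set won by the player who chose \<open>p\<close> against an opponent who chose \<open>q\<close>. Distances are
  taken from the vertex to be won towards the chosen vertices.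
\<close>

definition rvor_won :: "'v set \<Rightarrow> (nat \<Rightarrow> 'v set set) \<Rightarrow> 'v \<Rightarrow> 'v \<Rightarrow> 'v set" where
  "rvor_won V E p q = {v \<in> V. temporal_dist E v p < temporal_dist E v q}"

definition rvor_payoff1 :: "'v set \<Rightarrow> (nat \<Rightarrow> 'v set set) \<Rightarrow> 'v \<Rightarrow> 'v \<Rightarrow> nat" where
  "rvor_payoff1 V E p1 p2 = card (rvor_won V E p1 p2)"

definition rvor_payoff2 :: "'v set \<Rightarrow> (nat \<Rightarrow> 'v set set) \<Rightarrow> 'v \<Rightarrow> 'v \<Rightarrow> nat" where
  "rvor_payoff2 V E p1 p2 = card (rvor_won V E p2 p1)"

definition rvor_nash :: "'v set \<Rightarrow> (nat \<Rightarrow> 'v set set) \<Rightarrow> 'v \<Rightarrow> 'v \<Rightarrow> bool" where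
  "rvor_nash V E p1 p2 \<longleftrightarrow>
     p1 \<in> V \<and> p2 \<in> V \<and>
     (\<forall>p'\<in>V. rvor_payoff1 V E p' p2 \<le> rvor_payoff1 V E p1 p2) \<and>
     (\<forall>p'\<in>V. rvor_payoff2 V E p1 p' \<le> rvor_payoff2 V E p1 p2)"

end

theory Submission
  imports Defs
begin

text \<open>
  For \<open>k = 2\<close> take the parts \<open>{0, 1}\<close> and \<open>{2, 3, 4, 5}\<close>; vertices of equal parity are joined
  from time 1 on, vertex 1 is joined to 2 and 4 from time 2 on, and vertex 0 to 3 and 5 from time
  3 on. Here 2 and 4 are the best responses to 0, vertex 0 is the only best response to 1, and 1
  is the only best response to each of 2, 3, 4, 5, so no two vertices are best responses to each
  other. For larger \<open>k\<close> add \<open>k - 2\<close> singleton parts joined to everything from time 4 on. The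
  six old vertices reach each other before time 4, so their distances do not change, and an added
  vertex is at distance 4 to and from every other vertex. Hence an added vertex that is not chosen
  is tied, and choosing it wins at most itself, whereas some old vertex always wins at least 2.
\<close>

section \<open>Certificates for temporal distances\<close>

text \<open>By \<open>lower\<close>, no edge beats \<open>d\<close>, so no walk arrives at a vertex
  earlier than \<open>d\<close> allows. By \<open>upper\<close>, following predecessors back to
  \<open>u\<close> yields a walk arriving exactly at time \<open>d v\<close>.\<close>

lemma temporal_dist_eqI:
  fixes d :: "'v \<Rightarrow> nat"
  assumes start: "d u = 0"
    and lower: "\<And>t x y. 1 \<le> t \<Longrightarrow> {x, y} \<in> E t \<Longrightarrow> d x < t \<Longrightarrow> d y \<le> t"
    and upper: "\<And>v. v \<in> V \<Longrightarrow> v \<noteq> u \<Longrightarrow> \<exists>x\<in>V. d x < d v \<and> {x, v} \<in> E (d v)"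
    and v: "v \<in> V"
  shows "temporal_dist E u v = enat (d v)"
proof (cases "v = u")
  case True
  then show ?thesis by (simp add: temporal_dist_def start zero_enat_def)
next
  case False
  have "d v \<le> last ts" if walk: "temporal_walk E u v vs ts" for vs ts
  proof -
    \<comment> \<open>The strict premise of \<open>lower\<close> holds because
      \<open>d u = 0\<close> lies below the first time and later times increase strictly.\<close>
    have step: "d (vs ! Suc i) \<le> ts ! i" if "i < length ts" for i
      using that
    proof (induction i)
      case 0
      have "vs ! 0 = u"
        using walk by (cases vs) (auto simp: temporal_walk_def)
      then show ?case
        using walk 0 start lower[of "ts ! 0" "vs ! 0" "vs ! Suc 0"]
        by (auto simp: temporal_walk_def)
    next
      case (Suc i)
      have "ts ! i < ts ! Suc i"
        using walk Suc.prems by (auto simp: temporal_walk_def sorted_wrt_iff_nth_less)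
      then show ?case
        using walk Suc lower[of "ts ! Suc i" "vs ! Suc i" "vs ! Suc (Suc i)"]
        by (auto simp: temporal_walk_def)
    qed
    have "ts \<noteq> []" "length vs = Suc (length ts)" "last vs = v"
      using walk by (auto simp: temporal_walk_def)
    then show ?thesis
      using step[of "length ts - 1"] by (cases vs) (auto simp: last_conv_nth)
  qed
  moreover have "\<exists>vs ts. temporal_walk E u v vs ts \<and> d v = last ts"
    using v False
  proof (induction "d v" arbitrary: v rule: less_induct)
    case less
    obtain x where x: "x \<in> V" "d x < d v" "{x, v} \<in> E (d v)"
      using upper less.prems by blast
    show ?case
    proof (cases "x = u")
      case True
      have "temporal_walk E u v [u, v] [d v]"
        using x True by (auto simp: temporal_walk_def)
      then show ?thesis by force
    next
      case False
      then obtain vs ts where walk: "temporal_walk E u x vs ts" and last: "d x = last ts"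
        using less.hyps x by blast
      have ts: "ts \<noteq> []" "sorted_wrt (<) ts" "length vs = Suc (length ts)" "last vs = x"
        "vs \<noteq> []" "hd vs = u"
        using walk by (auto simp: temporal_walk_def)
      have "sorted_wrt (<) (butlast ts @ [d x])"
        using ts(1,2) last by (metis append_butlast_last_id)
      then have "sorted_wrt (<) ((butlast ts @ [d x]) @ [d v])"
        using x(2) by (force simp: sorted_wrt_append)
      then have "sorted_wrt (<) (ts @ [d v])"
        using ts(1) last by (metis append_butlast_last_id)
      moreover have "vs ! length ts = x"
        using ts by (simp add: last_conv_nth)
      ultimately have "temporal_walk E u v (vs @ [v]) (ts @ [d v])"
        using walk x ts by (auto simp: temporal_walk_def nth_append less_Suc_eq)
      then show ?thesis by force
    qed
  qed
  ultimately have "Inf {enat (last ts) | vs ts. temporal_walk E u v vs ts} = enat (d v)"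
    by (intro antisym Inf_lower Inf_greatest) (blast, force)
  then show ?thesis
    using False by (simp add: temporal_dist_def)
qed

section \<open>The graphs and their distances\<close>

text \<open>The offset 4 numbers the singleton parts from 2 on, after the two core parts on the
  vertices 0 to 5.\<close>

definition part :: "nat \<Rightarrow> nat" where
  "part v = (if v < 2 then 0 else if v < 6 then 1 else v - 4)"

text \<open>For vertices in different parts, the time from which they are joined.\<close>

definition label :: "nat \<Rightarrow> nat \<Rightarrow> nat" where
  "label x y =
     (if 6 \<le> max x y then 4 else if even (x + y) then 1 else if min x y = 0 then 3 else 2)"

definition edges :: "nat \<Rightarrow> nat \<Rightarrow> nat set set" where
  "edges n t = {{x, y} | x y. x < n \<and> y < n \<and> part x \<noteq> part y \<and> label x y \<le> t}"

text \<open>Rows are sources and columns are targets, so the game compares two columns.\<close>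

definition dist_table :: "nat list list" where
  "dist_table =
     [[0, 2, 1, 3, 1, 3],
      [3, 0, 2, 1, 2, 1],
      [1, 2, 0, 3, 2, 3],
      [3, 1, 2, 0, 2, 2],
      [1, 2, 2, 3, 0, 3],
      [3, 1, 2, 2, 2, 0]]"

definition tdist :: "nat \<Rightarrow> nat \<Rightarrow> nat" where
  "tdist u v = (if u = v then 0 else if u < 6 \<and> v < 6 then dist_table ! u ! v else 4)"

lemma label_commute: "label x y = label y x"
  by (simp add: label_def max.commute min.commute add.commute)

lemma label_bounds: "1 \<le> label x y" "label x y \<le> 4"
  by (auto simp: label_def)

lemma edges_iff:
  "{x, y} \<in> edges n t \<longleftrightarrow> x < n \<and> y < n \<and> part x \<noteq> part y \<and> label x y \<le> t"
  by (auto simp: edges_def doubleton_eq_iff label_commute)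

text \<open>Makes bounded quantifiers executable, so that \<open>code_simp\<close> can check the
  core by enumeration.\<close>

lemma all_less_upt: "(\<forall>x<n. P x) \<longleftrightarrow> (\<forall>x\<in>set [0..<n]. P x)"
  by auto

text \<open>The last stop before \<open>v\<close> on a fastest walk between distinct core vertices:
  \<open>u\<close> itself, or a neighbour of \<open>u\<close> of equal parity, reached at time
  1.\<close>

definition penultimate :: "nat \<Rightarrow> nat \<Rightarrow> nat" where
  "penultimate u v = (if 2 \<le> v then u mod 2 else if u < 2 then u + 2 else u)"

lemma tdist_core_le: "\<forall>u<6. \<forall>y<6. tdist u y \<le> 3"
  unfolding all_less_upt by code_simp

text \<open>The maximum is the earliest time at which the edge can be used after reaching
  \<open>x\<close>; this turns the condition for all \<open>t\<close> into a finite check.\<close>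

lemma tdist_core_step:
  "\<forall>u<6. \<forall>x<6. \<forall>y<6. part x \<noteq> part y \<longrightarrow> tdist u y \<le> max (label x y) (Suc (tdist u x))"
  unfolding all_less_upt by code_simp

lemma tdist_core_penultimate:
  "\<forall>u<6. \<forall>y<6. y \<noteq> u \<longrightarrow>
     tdist u (penultimate u y) < tdist u y \<and> part (penultimate u y) \<noteq> part y \<and>
     label (penultimate u y) y \<le> tdist u y"
  unfolding all_less_upt by code_simp

lemma tdist_le: "tdist u v \<le> 4"
  using tdist_core_le by (cases "u < 6 \<and> v < 6") (fastforce, auto simp: tdist_def)

lemma temporal_dist_edges:
  assumes n: "6 \<le> n" and "u < n" "v < n"
  shows "temporal_dist (edges n) u v = enat (tdist u v)"
proof (rule temporal_dist_eqI[where V = "{..<n}"])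
  show "tdist u u = 0" by (simp add: tdist_def)
  show "v \<in> {..<n}" using assms by simp
next
  fix t x y
  assume "1 \<le> t" "{x, y} \<in> edges n t" and lt: "tdist u x < t"
  then have xy: "part x \<noteq> part y" "label x y \<le> t" by (auto simp: edges_iff)
  show "tdist u y \<le> t"
  proof (cases "u < 6 \<and> y < 6 \<and> x < 6")
    case True
    then show ?thesis using tdist_core_step xy lt by fastforce
  next
    case False
    \<comment> \<open>If \<open>x\<close> or \<open>y\<close> is an added vertex, the label is 4 and
      \<open>t \<ge> 4\<close>; if only \<open>u\<close> is, then \<open>x\<close> is reached at
      time 4 and \<open>t > 4\<close>. The bound 4 suffices in both cases.\<close>
    then show ?thesis using tdist_le[of u y] xy lt by (auto simp: label_def tdist_def split: if_splits)
  qed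
next
  fix v assume v: "v \<in> {..<n}" "v \<noteq> u"
  show "\<exists>x\<in>{..<n}. tdist u x < tdist u v \<and> {x, v} \<in> edges n (tdist u v)"
  proof (cases "u < 6 \<and> v < 6")
    case True
    moreover have "penultimate u v < 6" using True by (auto simp: penultimate_def)
    ultimately show ?thesis
      using tdist_core_penultimate v n by (intro bexI[of _ "penultimate u v"]) (auto simp: edges_iff)
  next
    case False
    \<comment> \<open>An added vertex is alone in its part, so the direct edge from \<open>u\<close>
      exists by time 4.\<close>
    then have "part u \<noteq> part v" using v by (auto simp: part_def)
    then show ?thesis
      using False v assms label_bounds[of u v]
      by (intro bexI[of _ u]) (auto simp: edges_iff tdist_def)
  qed
qed

section \<open>Payoffs and best responses\<close>

lemma rvor_won_edges:
  assumes "6 \<le> n" "p < n" "q < n"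
  shows "rvor_won {..<n} (edges n) p q = {v. v < n \<and> tdist v p < tdist v q}"
  using assms by (auto simp: rvor_won_def temporal_dist_edges)

definition payoff :: "nat \<Rightarrow> nat \<Rightarrow> nat \<Rightarrow> nat" where
  "payoff n p q = card {v. v < n \<and> tdist v p < tdist v q}"

lemma rvor_nash_edges_iff:
  assumes "6 \<le> n"
  shows "rvor_nash {..<n} (edges n) p q \<longleftrightarrow>
    p < n \<and> q < n \<and> (\<forall>p'<n. payoff n p' q \<le> payoff n p q) \<and>
    (\<forall>q'<n. payoff n q' p \<le> payoff n q p)"
  using assms
  by (auto simp: rvor_nash_def rvor_payoff1_def rvor_payoff2_def payoff_def rvor_won_edges)

definition core_payoff :: "nat \<Rightarrow> nat \<Rightarrow> nat" where
  "core_payoff p q = length (filter (\<lambda>v. tdist v p < tdist v q) [0..<6])"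

text \<open>Added vertices are at distance 4 to both choices, hence tied.\<close>

lemma payoff_core:
  assumes "6 \<le> n" "p < 6" "q < 6"
  shows "payoff n p q = core_payoff p q"
proof -
  have "{v. v < n \<and> tdist v p < tdist v q} = set (filter (\<lambda>v. tdist v p < tdist v q) [0..<6])"
    using assms by (auto simp: tdist_def split: if_splits simp del: upt_rec_numeral)
  then show ?thesis
    unfolding payoff_def core_payoff_def by (metis distinct_card distinct_filter distinct_upt)
qed

text \<open>All other vertices are at distance 4 to \<open>p\<close>, the largest distance there is,
  so none of them can be strictly closer to \<open>p\<close>.\<close>

lemma payoff_extra_le: "6 \<le> p \<Longrightarrow> payoff n p q \<le> 1"
proof -
  assume p: "6 \<le> p"
  have "tdist v p = 4" if "v \<noteq> p" for v using p that by (auto simp: tdist_def)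
  then have "{v. v < n \<and> tdist v p < tdist v q} \<subseteq> {p}"
    using tdist_le by (force simp: not_less[symmetric])
  then show ?thesis
    unfolding payoff_def using card_mono[of "{p}"] by simp
qed

lemma payoff_vs_extra:
  assumes "6 \<le> n" "p < 6" "6 \<le> q"
  shows "6 \<le> payoff n p q"
proof -
  have "{..<6} \<subseteq> {v. v < n \<and> tdist v p < tdist v q}"
    using assms tdist_core_le by (fastforce simp: tdist_def[of _ q])
  then show ?thesis
    unfolding payoff_def using card_mono[of "{v. v < n \<and> tdist v p < tdist v q}" "{..<6}"] by simp
qed

text \<open>Of the two best responses 2 and 4 to vertex 0, the first is picked.\<close>

definition best_response :: "nat \<Rightarrow> nat" where
  "best_response q = (if q = 0 then 2 else if q = 1 then 0 else 1)"

text \<open>The bound 2 exceeds what an added vertex can win; the second conjunct gives one of the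
  players a profitable deviation from every core profile.\<close>

lemma core_payoff_best_response:
  "\<forall>q<6. 2 \<le> core_payoff (best_response q) q \<and>
     (\<forall>p<6. core_payoff p q < core_payoff (best_response q) q \<or>
       core_payoff q p < core_payoff (best_response p) p)"
  unfolding all_less_upt by code_simp

lemma no_nash_edges:
  assumes n: "6 \<le> n"
  shows "\<not> rvor_nash {..<n} (edges n) p q"
proof
  assume "rvor_nash {..<n} (edges n) p q"
  then have nash: "\<And>r. r < n \<Longrightarrow> payoff n r q \<le> payoff n p q"
      "\<And>r. r < n \<Longrightarrow> payoff n r p \<le> payoff n q p"
    using n by (auto simp: rvor_nash_edges_iff)
  \<comment> \<open>Every choice \<open>s\<close> has a reply winning at least 2, so an added
    vertex, winning at most 1, is never chosen in an equilibrium.\<close>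
  have good: "\<exists>r<n. 2 \<le> payoff n r s" for s
  proof (cases "s < 6")
    case True
    then have "best_response s < 6" "2 \<le> payoff n (best_response s) s"
      using core_payoff_best_response payoff_core[OF n] by (auto simp: best_response_def)
    then show ?thesis using n less_le_trans by blast
  next
    case False
    then show ?thesis using payoff_vs_extra[OF n, of 0 s] n by (intro exI[of _ 0]) auto
  qed
  have "p < 6"
    using good[of q] nash(1) payoff_extra_le[of p n q] by fastforce
  moreover have "q < 6"
    using good[of p] nash(2) payoff_extra_le[of q n p] by fastforce
  moreover have "best_response s < 6" for s
    by (simp add: best_response_def)
  ultimately have "payoff n p q < payoff n (best_response q) q \<or>
      payoff n q p < payoff n (best_response p) p"
    using core_payoff_best_response payoff_core[OF n] by metis
  moreover have "best_response s < n" for s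
    using n by (simp add: best_response_def)
  ultimately show False using nash by (meson not_less)
qed

section \<open>The underlying complete multipartite graph\<close>

lemma underlying_edges_edges:
  "underlying_edges (edges n) = {{x, y} | x y. x < n \<and> y < n \<and> part x \<noteq> part y}"
  using label_bounds unfolding underlying_edges_def edges_def by fastforce

lemma complete_multipartite_edges:
  assumes "2 \<le> k"
  shows "complete_multipartite k {..<k + 4} (underlying_edges (edges (k + 4)))"
proof -
  define B where "B i = {v. v < k + 4 \<and> part v = i}" for i
  have ne: "B i \<noteq> {}" if "i < k" for i
  proof -
    \<comment> \<open>The smallest vertex of part \<open>i\<close>.\<close>
    have "(if i = 0 then 0 else if i = 1 then 2 else i + 4) \<in> B i"
      using that assms by (auto simp: B_def part_def)
    then show ?thesis by blast
  qed
  have part_less: "part v < k" if "v < k + 4" for v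
    using that assms by (auto simp: part_def)
  have disj: "B i \<inter> B j = {}" if "i \<noteq> j" for i j
    using that by (auto simp: B_def)
  \<comment> \<open>Classes with different indices are disjoint, so if equal they would be
    empty.\<close>
  have inj: "inj_on B {..<k}"
    using ne disj by (intro inj_onI) (metis Int_absorb lessThan_iff)
  have "partition_on {..<k + 4} (B ` {..<k})"
  proof (rule partition_onI)
    show "\<Union> (B ` {..<k}) = {..<k + 4}"
      using part_less by (auto simp: B_def)
    show "disjnt p q" if "p \<in> B ` {..<k}" "q \<in> B ` {..<k}" "p \<noteq> q" for p q
      using that disj unfolding disjnt_def by (metis imageE)
    show "{} \<notin> B ` {..<k}"
      using ne by auto
  qed
  moreover have "card (B ` {..<k}) = k"
    using inj by (simp add: card_image)
  moreover have "underlying_edges (edges (k + 4)) =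
    {{u, v} | u v A C. A \<in> B ` {..<k} \<and> C \<in> B ` {..<k} \<and> A \<noteq> C \<and> u \<in> A \<and> v \<in> C}"
    (is "?L = ?R")
  proof
    show "?L \<subseteq> ?R"
    proof
      fix e assume "e \<in> ?L"
      then obtain x y where e: "e = {x, y}" "x < k + 4" "y < k + 4" "part x \<noteq> part y"
        by (auto simp: underlying_edges_edges)
      then have "x \<in> B (part x)" "y \<in> B (part y)" "B (part x) \<noteq> B (part y)"
        by (auto simp: B_def)
      then show "e \<in> ?R" using e part_less by blast
    qed
    show "?R \<subseteq> ?L"
      by (auto simp: underlying_edges_edges B_def)
  qed
  ultimately show ?thesis
    unfolding complete_multipartite_def by blast
qed

lemma temporal_graph_edges:
  assumes "0 < n"
  shows "temporal_graph {..<n} (edges n)"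
proof -
  \<comment> \<open>No label exceeds 4.\<close>
  have "edges n t = edges n 4" if "4 \<le> t" for t
    using label_bounds that unfolding edges_def by (metis le_trans)
  moreover have "edges n t \<subseteq> {e. e \<subseteq> {..<n} \<and> card e = 2}" for t
    by (auto simp: edges_def card_2_iff)
  ultimately show ?thesis
    using assms unfolding temporal_graph_def by (auto intro!: exI[of _ 4])
qed

theorem corollary5:
  fixes k :: nat
  assumes "k \<ge> 2"
  shows "\<exists>(V :: nat set) E.
           temporal_complete_multipartite k V E \<and> monotonically_growing E \<and>
           \<not> (\<exists>p1 p2. rvor_nash V E p1 p2)"
proof (intro exI conjI)
  \<comment> \<open>Six core vertices and \<open>k - 2\<close> singleton parts make
    \<open>k + 4\<close> vertices.\<close>
  show "temporal_complete_multipartite k {..<k + 4} (edges (k + 4))"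
    using assms temporal_graph_edges complete_multipartite_edges
    by (simp add: temporal_complete_multipartite_def)
  show "monotonically_growing (edges (k + 4))"
    unfolding monotonically_growing_def edges_def by fastforce
  show "\<not> (\<exists>p1 p2. rvor_nash {..<k + 4} (edges (k + 4)) p1 p2)"
    using no_nash_edges assms by simp
qed

end
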